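(* Let $X$ be a finite set and let $\sigma:X\times X\to X\times X$ be a birack, with $\sigma(x,y)=(\sigma_1(x,y),\sigma_2(x,y))$. Let $S:X\times X\to X\times X$ be the sideways map of $\sigma$, i.e. the unique invertible map satisfying $S(\sigma_1(x,y),x)=(\sigma_2(x,y),y)$ for all $x,y\in X$. Then $S$ and $S^{-1}$ are diagonally bijective: writing $S^{\pm1}=(S^{\pm1}_1,S^{\pm1}_2)$ and $\Delta(x)=(x,x)$, each of the four maps $S_1\circ\Delta$, $S_2\circ\Delta$, $S^{-1}_1\circ\Delta$, $S^{-1}_2\circ\Delta$ from $X$ to $X$ is a bijection.
   Context: A birack on $X$ is a bijective map $\sigma:X\times X\to X\times X$, $\sigma(x,y)=(g_x(y),f_y(x))$, satisfying the braid equation $(\sigma\times \mathrm{Id})(\mathrm{Id}\times\sigma)(\sigma\times \mathrm{Id})=(\mathrm{Id}\times\sigma)(\sigma\times \mathrm{Id})(\mathrm{Id}\times\sigma)$, such that all $g_x:X\to X$ (left non-degeneracy) and all $f_y:X\to X$ (right non-degeneracy) are bijective. Thus $\sigma_1(x,y)=g_x(y)$ and $\sigma_2(x,y)=f_y(x)$. *)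

theory Defs
  imports "HOL-Library.FuncSet"
begin

text \<open>The set \<open>X\<close> is an explicit, possibly empty, carrier. Maps are only constrained on
  the carrier; their values elsewhere play no role.\<close>

definition first_two :: "('a \<times> 'a \<Rightarrow> 'a \<times> 'a) \<Rightarrow> 'a \<times> 'a \<times> 'a \<Rightarrow> 'a \<times> 'a \<times> 'a" where
  "first_two \<sigma> = (\<lambda>(x, y, z). (fst (\<sigma> (x, y)), snd (\<sigma> (x, y)), z))"

definition last_two :: "('a \<times> 'a \<Rightarrow> 'a \<times> 'a) \<Rightarrow> 'a \<times> 'a \<times> 'a \<Rightarrow> 'a \<times> 'a \<times> 'a" where
  "last_two \<sigma> = (\<lambda>(x, y, z). (x, \<sigma> (y, z)))"

definition braid_equation :: "'a set \<Rightarrow> ('a \<times> 'a \<Rightarrow> 'a \<times> 'a) \<Rightarrow> bool" where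
  "braid_equation X \<sigma> \<longleftrightarrow>
     (\<forall>t \<in> X \<times> X \<times> X.
        (first_two \<sigma> \<circ> last_two \<sigma> \<circ> first_two \<sigma>) t = (last_two \<sigma> \<circ> first_two \<sigma> \<circ> last_two \<sigma>) t)"

definition birack :: "'a set \<Rightarrow> ('a \<times> 'a \<Rightarrow> 'a \<times> 'a) \<Rightarrow> bool" where
  "birack X \<sigma> \<longleftrightarrow>
     bij_betw \<sigma> (X \<times> X) (X \<times> X) \<and>
     braid_equation X \<sigma> \<and>
     (\<forall>x \<in> X. bij_betw (\<lambda>y. fst (\<sigma> (x, y))) X X) \<and>
     (\<forall>y \<in> X. bij_betw (\<lambda>x. snd (\<sigma> (x, y))) X X)"

definition sideways_map :: "'a set \<Rightarrow> ('a \<times> 'a \<Rightarrow> 'a \<times> 'a) \<Rightarrow> ('a \<times> 'a \<Rightarrow> 'a \<times> 'a) \<Rightarrow> bool" where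
  "sideways_map X \<sigma> S \<longleftrightarrow>
     bij_betw S (X \<times> X) (X \<times> X) \<and>
     (\<forall>x \<in> X. \<forall>y \<in> X. S (fst (\<sigma> (x, y)), x) = (snd (\<sigma> (x, y)), y))"

definition diag :: "'a \<Rightarrow> 'a \<times> 'a" where
  "diag x = (x, x)"

definition diagonally_bijective :: "'a set \<Rightarrow> ('a \<times> 'a \<Rightarrow> 'a \<times> 'a) \<Rightarrow> bool" where
  "diagonally_bijective X T \<longleftrightarrow>
     bij_betw (fst \<circ> T \<circ> diag) X X \<and> bij_betw (snd \<circ> T \<circ> diag) X X"

text \<open>The sideways map of a birack exists and is unique as a map on \<open>X \<times> X\<close>; restricting
  to \<open>extensional\<close> fixes its irrelevant values off the carrier.\<close>

lemma bij_betw_left_sideways: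
  assumes "birack X \<sigma>"
  shows "bij_betw (\<lambda>(x, y). (fst (\<sigma> (x, y)), x)) (X \<times> X) (X \<times> X)"
proof -
  have g: "bij_betw (\<lambda>y. fst (\<sigma> (x, y))) X X" if "x \<in> X" for x
    using assms that by (simp add: birack_def)
  have "inj_on (\<lambda>(x, y). (fst (\<sigma> (x, y)), x)) (X \<times> X)"
    using g by (auto simp: inj_on_def bij_betw_def)
  moreover have "p \<in> (\<lambda>(x, y). (fst (\<sigma> (x, y)), x)) ` (X \<times> X)" if "p \<in> X \<times> X" for p
  proof -
    obtain a x where p: "p = (a, x)" "a \<in> X" "x \<in> X" using \<open>p \<in> X \<times> X\<close> by blast
    then obtain y where "y \<in> X" "a = fst (\<sigma> (x, y))"
      using g[of x] by (auto simp: bij_betw_def)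
    then show ?thesis using p by (intro image_eqI[of _ _ "(x, y)"]) auto
  qed
  moreover have "(\<lambda>(x, y). (fst (\<sigma> (x, y)), x)) ` (X \<times> X) \<subseteq> X \<times> X"
    using g by (auto dest: bij_betwE)
  ultimately show ?thesis unfolding bij_betw_def by blast
qed

lemma bij_betw_right_sideways:
  assumes "birack X \<sigma>"
  shows "bij_betw (\<lambda>(x, y). (snd (\<sigma> (x, y)), y)) (X \<times> X) (X \<times> X)"
proof -
  have f: "bij_betw (\<lambda>x. snd (\<sigma> (x, y))) X X" if "y \<in> X" for y
    using assms that by (simp add: birack_def)
  have "inj_on (\<lambda>(x, y). (snd (\<sigma> (x, y)), y)) (X \<times> X)"
    using f by (auto simp: inj_on_def bij_betw_def)
  moreover have "p \<in> (\<lambda>(x, y). (snd (\<sigma> (x, y)), y)) ` (X \<times> X)" if "p \<in> X \<times> X" for p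
  proof -
    obtain b y where p: "p = (b, y)" "b \<in> X" "y \<in> X" using \<open>p \<in> X \<times> X\<close> by blast
    then obtain x where "x \<in> X" "b = snd (\<sigma> (x, y))"
      using f[of y] by (auto simp: bij_betw_def)
    then show ?thesis using p by (intro image_eqI[of _ _ "(x, y)"]) auto
  qed
  moreover have "(\<lambda>(x, y). (snd (\<sigma> (x, y)), y)) ` (X \<times> X) \<subseteq> X \<times> X"
    using f by (auto dest: bij_betwE)
  ultimately show ?thesis unfolding bij_betw_def by blast
qed

lemma sideways_map_exists_unique:
  assumes "birack X \<sigma>"
  shows "\<exists>!S. S \<in> extensional (X \<times> X) \<and> sideways_map X \<sigma> S"
proof (rule ex_ex1I)
  let ?L = "\<lambda>(x, y). (fst (\<sigma> (x, y)), x)"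
  let ?R = "\<lambda>(x, y). (snd (\<sigma> (x, y)), y)"
  let ?S = "restrict (?R \<circ> the_inv_into (X \<times> X) ?L) (X \<times> X)"
  note L = bij_betw_left_sideways[OF assms]
  note R = bij_betw_right_sideways[OF assms]
  have bij: "bij_betw ?S (X \<times> X) (X \<times> X)"
    using bij_betw_trans[OF bij_betw_the_inv_into[OF L] R]
    by (rule bij_betw_cong[THEN iffD1, rotated]) simp
  have "?S (fst (\<sigma> (x, y)), x) = (snd (\<sigma> (x, y)), y)" if "x \<in> X" "y \<in> X" for x y
  proof -
    have "the_inv_into (X \<times> X) ?L (?L (x, y)) = (x, y)"
      using L that by (intro the_inv_into_f_f) (auto simp: bij_betw_def)
    moreover have "?L (x, y) \<in> X \<times> X" using L that by (blast dest: bij_betwE)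
    ultimately show ?thesis by simp
  qed
  then have "sideways_map X \<sigma> ?S" unfolding sideways_map_def using bij by blast
  then show "\<exists>S. S \<in> extensional (X \<times> X) \<and> sideways_map X \<sigma> S"
    using restrict_extensional by blast
next
  fix S T
  assume S: "S \<in> extensional (X \<times> X) \<and> sideways_map X \<sigma> S"
    and T: "T \<in> extensional (X \<times> X) \<and> sideways_map X \<sigma> T"
  show "S = T"
  proof (rule extensionalityI[of S "X \<times> X" T])
    fix p assume "p \<in> X \<times> X"
    then have "p \<in> (\<lambda>(x, y). (fst (\<sigma> (x, y)), x)) ` (X \<times> X)"
      using bij_betw_left_sideways[OF assms] by (simp add: bij_betw_def)
    then obtain x y where "x \<in> X" "y \<in> X" "p = (fst (\<sigma> (x, y)), x)" by auto
    then show "S p = T p" using S T by (simp add: sideways_map_def)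
  qed (use S T in auto)
qed

end

theory Submission
  imports Defs
begin

text \<open>Write \<open>\<sigma> (x, y) = (g\<^sub>x y, f\<^sub>y x)\<close> and let \<open>S (a, a) = (b, y)\<close>, that is
  \<open>\<sigma> (a, y) = (a, b)\<close>. Pick \<open>c\<close> with \<open>f\<^sub>a c = a\<close>; the third coordinate of the braid equation at
  \<open>(c, a, y)\<close> reads \<open>b = f\<^sub>b a\<close>, so the second coordinate of \<open>S\<inverse> (b, b)\<close> is \<open>a\<close>. Hence
  \<open>S\<inverse>\<^sub>2 \<circ> \<Delta>\<close> is a left inverse of \<open>S\<^sub>1 \<circ> \<Delta>\<close>, and dually \<open>S\<^sub>2 \<circ> \<Delta>\<close> is a left inverse of
  \<open>S\<inverse>\<^sub>1 \<circ> \<Delta>\<close>. On a finite set, one-sided inverses are bijections.\<close>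

lemma finite_left_inverse_bij_betw:
  assumes "finite X" "f ` X \<subseteq> X" "\<And>x. x \<in> X \<Longrightarrow> h (f x) = x"
  shows "bij_betw f X X" and "bij_betw h X X"
proof -
  have "inj_on f X" using assms(3) by (rule inj_on_inverseI)
  then have "f ` X = X" using assms by (simp add: endo_inj_surj)
  then show f: "bij_betw f X X" using \<open>inj_on f X\<close> by (simp add: bij_betw_def)
  have "h ` f ` X = X" using assms(3) by (simp add: image_image)
  then have "h ` X = X" unfolding \<open>f ` X = X\<close> .
  then show "bij_betw h X X"
    using assms(1) by (simp add: bij_betw_def eq_card_imp_inj_on)
qed

lemma birack_closed:
  assumes "birack X \<sigma>" "x \<in> X" "y \<in> X"
  shows "fst (\<sigma> (x, y)) \<in> X" and "snd (\<sigma> (x, y)) \<in> X"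
  using assms by (auto simp: birack_def dest: bij_betwE)

lemma birack_braid:
  assumes "birack X \<sigma>" "x \<in> X" "y \<in> X" "z \<in> X"
  shows "(first_two \<sigma> \<circ> last_two \<sigma> \<circ> first_two \<sigma>) (x, y, z)
       = (last_two \<sigma> \<circ> first_two \<sigma> \<circ> last_two \<sigma>) (x, y, z)"
  using assms by (simp add: birack_def braid_equation_def)

lemma birack_fix_first:
  assumes B: "birack X \<sigma>" and X: "a \<in> X" "y \<in> X" and s: "\<sigma> (a, y) = (a, b)"
  shows "snd (\<sigma> (a, b)) = b"
proof -
  have "(\<lambda>x. snd (\<sigma> (x, a))) ` X = X" using B X by (simp add: birack_def bij_betw_def)
  then obtain c d where c: "c \<in> X" "\<sigma> (c, a) = (d, a)"
    using X by (metis (no_types, lifting) imageE prod.collapse)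
  \<comment> \<open>Both sides of the braid equation at \<open>(c, a, y)\<close> pass through
    \<open>(d, a, b)\<close>. The last factor then acts on the first two entries on one side,
    keeping \<open>b\<close>, and on the last two on the other, giving
    \<open>snd (\<sigma> (a, b))\<close>.\<close>
  show ?thesis
    using birack_braid[OF B c(1) X] c(2) s
    by (simp add: first_two_def last_two_def) (metis snd_conv)
qed

text \<open>Mirror image of \<open>birack_fix_first\<close>: with
  \<open>\<sigma> (b, c) = (b, d)\<close>, both sides at \<open>(x, b, c)\<close> pass through
  \<open>(a, b, d)\<close>, and their first coordinates are compared.\<close>

lemma birack_fix_second:
  assumes B: "birack X \<sigma>" and X: "x \<in> X" "b \<in> X" and s: "\<sigma> (x, b) = (a, b)"
  shows "fst (\<sigma> (a, b)) = a"
proof -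
  have "(\<lambda>y. fst (\<sigma> (b, y))) ` X = X" using B X by (simp add: birack_def bij_betw_def)
  then obtain c d where c: "c \<in> X" "\<sigma> (b, c) = (b, d)"
    using X by (metis (no_types, lifting) imageE prod.collapse)
  show ?thesis
    using birack_braid[OF B X c(1)] c(2) s
    by (simp add: first_two_def last_two_def split: prod.splits)
qed

text \<open>By left non-degeneracy every pair of \<open>X \<times> X\<close> has the form
  \<open>(fst (\<sigma> (u, v)), u)\<close>, so the defining equation determines \<open>S\<close>
  everywhere on it.\<close>

lemma sideways_map_iff:
  assumes B: "birack X \<sigma>" and S: "sideways_map X \<sigma> S" and X: "a \<in> X" "x \<in> X"
  shows "S (a, x) = (b, y) \<longleftrightarrow> y \<in> X \<and> \<sigma> (x, y) = (a, b)"
proof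
  assume eq: "S (a, x) = (b, y)"
  obtain u v where uv: "u \<in> X" "v \<in> X" "(a, x) = (fst (\<sigma> (u, v)), u)"
    using bij_betw_left_sideways[OF B] X by (fastforce simp: bij_betw_def)
  then show "y \<in> X \<and> \<sigma> (x, y) = (a, b)"
    using S eq by (auto simp: sideways_map_def prod_eq_iff)
next
  assume "y \<in> X \<and> \<sigma> (x, y) = (a, b)"
  then show "S (a, x) = (b, y)" using S X by (force simp: sideways_map_def)
qed

theorem mainTheorem5:
  fixes X :: "'a set" and \<sigma> S :: "'a \<times> 'a \<Rightarrow> 'a \<times> 'a"
  assumes "finite X"
    and "birack X \<sigma>"
    and "sideways_map X \<sigma> S"
  shows "diagonally_bijective X S \<and> diagonally_bijective X (inv_into (X \<times> X) S)"
proof -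
  let ?R = "inv_into (X \<times> X) S"
  note iff = sideways_map_iff[OF assms(2,3)]
  have bij: "bij_betw S (X \<times> X) (X \<times> X)" using assms(3) by (simp add: sideways_map_def)
  have S_closed: "S p \<in> X \<times> X" if "p \<in> X \<times> X" for p using bij that by (rule bij_betw_apply)
  have R_closed: "?R p \<in> X \<times> X" if "p \<in> X \<times> X" for p
    using bij_betw_inv_into[OF bij] that by (rule bij_betw_apply)
  have S_R: "S (?R p) = p" if "p \<in> X \<times> X" for p using bij that by (rule bij_betw_inv_into_right)
  have R_S: "?R (S p) = p" if "p \<in> X \<times> X" for p using bij that by (rule bij_betw_inv_into_left)
  have RS: "(snd \<circ> ?R \<circ> diag) ((fst \<circ> S \<circ> diag) a) = a" if a: "a \<in> X" for a
  proof -
    obtain b y where Sa: "S (a, a) = (b, y)" by fastforce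
    then have X: "b \<in> X" "y \<in> X" and s: "\<sigma> (a, y) = (a, b)"
      using S_closed[of "(a, a)"] iff[OF a a] a Sa by auto
    \<comment> \<open>With this choice \<open>birack_fix_first\<close> says
      \<open>\<sigma> (a, b) = (?c, b)\<close>.\<close>
    let ?c = "fst (\<sigma> (a, b))"
    have c: "?c \<in> X" using birack_closed[OF assms(2)] a X by blast
    have "S (?c, a) = (b, b)"
      unfolding iff[OF c a] using birack_fix_first[OF assms(2) a X(2) s] X by (simp add: prod_eq_iff)
    then have "?R (b, b) = (?c, a)" using R_S[of "(?c, a)"] a c by simp
    then show ?thesis by (simp add: diag_def Sa)
  qed
  have SR: "(snd \<circ> S \<circ> diag) ((fst \<circ> ?R \<circ> diag) b) = b" if b: "b \<in> X" for b
  proof -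
    obtain a x where Rb: "?R (b, b) = (a, x)" by fastforce
    then have X: "a \<in> X" "x \<in> X" using R_closed[of "(b, b)"] b Rb by auto
    have "S (a, x) = (b, b)" using S_R[of "(b, b)"] Rb b by simp
    then have "\<sigma> (x, b) = (a, b)" using iff X by blast
    \<comment> \<open>The first coordinate of \<open>\<sigma> (a, b)\<close> is \<open>a\<close>, so
      \<open>S\<close> sends \<open>(a, a)\<close> to a pair ending in \<open>b\<close>.\<close>
    from birack_fix_second[OF assms(2) X(2) b this]
    have "S (a, a) = (snd (\<sigma> (a, b)), b)" unfolding iff[OF X(1) X(1)] using b by (simp add: prod_eq_iff)
    then show ?thesis by (simp add: diag_def Rb)
  qed
  have "(fst \<circ> S \<circ> diag) ` X \<subseteq> X" "(fst \<circ> ?R \<circ> diag) ` X \<subseteq> X"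
    using S_closed R_closed by (auto simp: diag_def mem_Times_iff)
  \<comment> \<open>Each instance yields two of the four bijections: a map and its left
    inverse.\<close>
  from finite_left_inverse_bij_betw[OF assms(1) this(1) RS]
    finite_left_inverse_bij_betw[OF assms(1) this(2) SR]
  show ?thesis unfolding diagonally_bijective_def by blast
qed

end
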